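(* Let $m\in\mathbb{Z}$ and let $D_{s,t,\varepsilon_1,\varepsilon_2}$ be the family of perturbed Dirac operators on the cylinder $M=\mathbb{R}\times S^1$ defined in the context. Take $s=\varepsilon_2=0$, with $t,\varepsilon_1\ge 0$. Then $$\ker_{L^2}(D^+_{0,t,\varepsilon_1,0})=\mathbb{C}\langle a_m(r)e^{2\pi\sqrt{-1}m\theta}\rangle,\qquad \ker_{L^2}(D^-_{0,t,\varepsilon_1,0})=0,$$ where $$a_m(r)=\exp\left(2\pi\int^r(1+t)(m-\rho)\,dr\right).$$ In particular, $$RR_{S^1,\mathrm{loc}}(M,L)=\mathbb{C}\langle a_m(r)e^{2\pi\sqrt{-1}m\theta}\rangle=\mathbb{C}_{(m)}.$$
   Context: Let $m\in\mathbb{Z}$, $M=\mathbb{R}\times S^1$ with coordinates $(r,\theta)$ ($S^1=\mathbb{R}/\mathbb{Z}$), metric $g=dr^2+d\theta^2$, symplectic form $\omega=dr\wedge d\theta$, almost complex structure $J\partial_r=\partial_\theta$, $J\partial_\theta=-\partial_r$. Let $W^+=M\times\mathbb{C}$, $W^-=TM_{\mathbb{C}}=(TM,J)$ with frame $\partial_\theta$, $W=W^+\oplus W^-$, with Clifford action $c(dr)=\begin{pmatrix}0&-\sqrt{-1}\\ -\sqrt{-1}&0\end{pmatrix}$, $c(d\theta)=\begin{pmatrix}0&-1\\ 1&0\end{pmatrix}$. Let $\rho:\mathbb{R}\to\mathbb{R}$ be a smooth non-decreasing function with $\rho(r)=r$ for $m-1/4<r<m+1/4$, $\rho(r)=m-1/2$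 for $r<m-1/2$, $\rho(r)=m+1/2$ for $r>m+1/2$. Let $\nabla^W=d-2\pi\sqrt{-1}\rho(r)\,d\theta$ be the Clifford connection and $$D=\begin{pmatrix}0&-\partial_\theta-\sqrt{-1}\partial_r+2\pi\sqrt{-1}\rho\\ \partial_\theta-\sqrt{-1}\partial_r-2\pi\sqrt{-1}\rho&0\end{pmatrix},\quad D_{S^1}=\begin{pmatrix}0&-\partial_\theta+2\pi\sqrt{-1}\rho\\ \partial_\theta-2\pi\sqrt{-1}\rho&0\end{pmatrix}.$$ $S^1$ acts on $M$ by rotation, with the lift to $W$ trivial on the fiber direction; the line spanned by a section $a(r)e^{2\pi\sqrt{-1}n\theta}$ is identified with the weight-$n$ representation $\mathbb{C}_{(n)}$. Put $\mu:=-2\pi\rho$ and $\mu^M:=-2\pi\rho\,\partial_\theta$ (the induced vector field). Let $f$ be a smooth positive function on $M$ depending only on $r$, with $f=|r|$ for $|r|$ sufficiently large. For $s,t,\varepsilon_1,\varepsilon_2\ge0$ put $D_{s,t,\varepsilon_1,\varepsilon_2}:=D+\sqrt{-1}sf^{\varepsilon_1}c(\mu^M)+tf^{\varepsilon_2}D_{S^1}=\begin{pmatrix}0&D^-_{s,t,\varepsilon_1,\varepsilon_2}\\ D^+_{s,t,\varepsilon_1,\varepsilon_2}&0\end{pmatrix}$, where $$D^{+}_{s,t,\varepsilon_1,\varepsilon_2}=(1+tf^{\varepsilon_2})(\partial_\theta-2\pi\sqrt{-1}\rho)-\sqrt{-1}\partial_r-2\pi\sqrt{-1}sf^{\varepsilon_1}\rho,$$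 $$D^{-}_{s,t,\varepsilon_1,\varepsilon_2}=-(1+tf^{\varepsilon_2})(\partial_\theta-2\pi\sqrt{-1}\rho)-\sqrt{-1}\partial_r+2\pi\sqrt{-1}sf^{\varepsilon_1}\rho.$$ $\ker_{L^2}$ denotes the space of $L^2$-solutions. These data are a completion, with cylindrical end and translational invariance on the end, of the standard Hamiltonian $S^1$-action on $(m-1/4,m+1/4)\times S^1$ with pre-quantizing line bundle $(L,\nabla)=(\underline{\mathbb{C}},d+\sqrt{-1}\mu\,d\theta)$. The $S^1$-equivariant local Riemann-Roch number $RR_{S^1,\mathrm{loc}}(M,L)$ here is the $S^1$-equivariant $L^2$-index $\ker_{L^2}(D^+_{0,t,\varepsilon_1,0})-\ker_{L^2}(D^-_{0,t,\varepsilon_1,0})$ ($t\gg1$) of the perturbation $D+tD_{S^1}$. $\int^r$ denotes a primitive (any choice, affecting $a_m$ only by a positive constant). *)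

theory Defs
  imports
    "HOL-Analysis.Analysis"
    "HOL-Library.Function_Algebras"
    "HOL-Library.Poly_Mapping"
begin

section \<open>Smooth functions\<close>

text \<open>For a finite-dimensional domain \<open>'a\<close>, \<open>Ck k f\<close> says that \<open>f\<close> is of class \<open>C\<^sup>k\<close> on
  the whole space: continuity of all directional derivatives is continuity of the derivative.\<close>

fun Ck :: "nat \<Rightarrow> ('a::real_normed_vector \<Rightarrow> 'b::real_normed_vector) \<Rightarrow> bool" where
  "Ck 0 f \<longleftrightarrow> continuous_on UNIV f"
| "Ck (Suc k) f \<longleftrightarrow>
     (\<forall>x. f differentiable (at x)) \<and> (\<forall>v. Ck k (\<lambda>x. frechet_derivative f (at x) v))"

definition smooth :: "('a::real_normed_vector \<Rightarrow> 'b::real_normed_vector) \<Rightarrow> bool" where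
  "smooth f \<longleftrightarrow> (\<forall>k. Ck k f)"


section \<open>Sections over the cylinder\<close>

text \<open>Points of \<open>\<real> \<times> S\<^sup>1\<close> with \<open>S\<^sup>1 = \<real>/\<int>\<close> are given by coordinates \<open>(r, \<theta>)\<close>, and functions on
  the cylinder are functions of \<open>(r, \<theta>)\<close> that are 1-periodic in \<open>\<theta>\<close>.  The bundle \<open>W\<^sup>+\<close> is trivial,
  and \<open>W\<^sup>- = TM\<close> (a complex line bundle via \<open>J\<close>) is trivialized by the frame
  \<open>\<partial>\<^sub>\<theta>\<close>, which has length 1; hence a section of either bundle is a complex function, and a section
  of \<open>W = W\<^sup>+ \<oplus> W\<^sup>-\<close> is a pair of complex functions.\<close>

type_synonym sect = "real \<times> real \<Rightarrow> complex"

definition smooth_section :: "sect \<Rightarrow> bool" where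
  "smooth_section u \<longleftrightarrow> smooth u \<and> (\<forall>r \<theta>. u (r, \<theta> + 1) = u (r, \<theta>))"

text \<open>The Riemannian measure of \<open>dr\<^sup>2 + d\<theta>\<^sup>2\<close> is Lebesgue measure on the fundamental domain
  \<open>\<real> \<times> [0,1)\<close>.\<close>

definition square_integrable :: "sect \<Rightarrow> bool" where
  "square_integrable u \<longleftrightarrow> set_integrable lborel (UNIV \<times> {0..<1}) (\<lambda>p. (norm (u p))\<^sup>2)"

definition ker_L2 :: "(sect \<Rightarrow> sect) \<Rightarrow> sect set" where
  "ker_L2 P = {u. smooth_section u \<and> square_integrable u \<and> P u = 0}"

definition cscale :: "complex \<Rightarrow> sect \<Rightarrow> sect" where
  "cscale c u = (\<lambda>p. c * u p)"

interpretation sect_space: vector_space cscale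
  by unfold_locales (auto simp: cscale_def fun_eq_iff algebra_simps)

text \<open>The section \<open>a(r) e\<^bsup>2\<pi>in\<theta>\<^esup>\<close>.\<close>

definition fourier_section :: "(real \<Rightarrow> real) \<Rightarrow> int \<Rightarrow> sect" where
  "fourier_section a n =
     (\<lambda>(r, \<theta>). of_real (a r) * exp (2 * of_real pi * \<i> * of_int n * of_real \<theta>))"


section \<open>The Dirac operator and its perturbations\<close>

definition partial_r :: "sect \<Rightarrow> sect" where
  "partial_r u = (\<lambda>p. frechet_derivative u (at p) (1, 0))"

definition partial_theta :: "sect \<Rightarrow> sect" where
  "partial_theta u = (\<lambda>p. frechet_derivative u (at p) (0, 1))"

text \<open>The two components of the connection \<open>d - 2\<pi>i \<rho>(r) d\<theta>\<close>, on either summand of \<open>W\<close>.\<close>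

definition nabla_r :: "sect \<Rightarrow> sect" where
  "nabla_r u = partial_r u"

definition nabla_theta :: "(real \<Rightarrow> real) \<Rightarrow> sect \<Rightarrow> sect" where
  "nabla_theta \<rho> u = (\<lambda>p. partial_theta u p - 2 * of_real pi * \<i> * of_real (\<rho> (fst p)) * u p)"

text \<open>Clifford multiplication by \<open>dr\<close> and \<open>d\<theta>\<close>: the matrices with rows \<open>(0, -i), (-i, 0)\<close> and
  \<open>(0, -1), (1, 0)\<close>.\<close>

definition clifford_dr :: "sect \<times> sect \<Rightarrow> sect \<times> sect" where
  "clifford_dr = (\<lambda>(u, v). (\<lambda>p. - \<i> * v p, \<lambda>p. - \<i> * u p))"

definition clifford_dtheta :: "sect \<times> sect \<Rightarrow> sect \<times> sect" where
  "clifford_dtheta = (\<lambda>(u, v). (\<lambda>p. - v p, \<lambda>p. u p))"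

definition mult_r :: "(real \<Rightarrow> complex) \<Rightarrow> sect \<times> sect \<Rightarrow> sect \<times> sect" where
  "mult_r h = (\<lambda>(u, v). (\<lambda>p. h (fst p) * u p, \<lambda>p. h (fst p) * v p))"

definition dirac_S1 :: "(real \<Rightarrow> real) \<Rightarrow> sect \<times> sect \<Rightarrow> sect \<times> sect" where
  "dirac_S1 \<rho> = (\<lambda>(u, v). clifford_dtheta (nabla_theta \<rho> u, nabla_theta \<rho> v))"

definition dirac :: "(real \<Rightarrow> real) \<Rightarrow> sect \<times> sect \<Rightarrow> sect \<times> sect" where
  "dirac \<rho> = (\<lambda>(u, v). clifford_dr (nabla_r u, nabla_r v) + dirac_S1 \<rho> (u, v))"

definition mu :: "(real \<Rightarrow> real) \<Rightarrow> real \<Rightarrow> real" where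
  "mu \<rho> r = - 2 * pi * \<rho> r"

text \<open>Clifford multiplication by the vector field \<open>\<mu>\<^sup>M = \<mu> \<partial>\<^sub>\<theta>\<close>, which the metric
  identifies with the 1-form \<open>\<mu> d\<theta>\<close>.\<close>

definition clifford_muM :: "(real \<Rightarrow> real) \<Rightarrow> sect \<times> sect \<Rightarrow> sect \<times> sect" where
  "clifford_muM \<rho> w = mult_r (\<lambda>r. of_real (mu \<rho> r)) (clifford_dtheta w)"

text \<open>The function \<open>f\<close> on the cylinder depends only on \<open>r\<close> and is given as a function of \<open>r\<close>.\<close>

definition perturbed_dirac ::
  "(real \<Rightarrow> real) \<Rightarrow> (real \<Rightarrow> real) \<Rightarrow> real \<Rightarrow> real \<Rightarrow> real \<Rightarrow> real \<Rightarrow> sect \<times> sect \<Rightarrow> sect \<times> sect" where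
  "perturbed_dirac \<rho> f s t \<epsilon>1 \<epsilon>2 w =
     dirac \<rho> w
     + mult_r (\<lambda>r. \<i> * of_real (s * f r powr \<epsilon>1)) (clifford_muM \<rho> w)
     + mult_r (\<lambda>r. of_real (t * f r powr \<epsilon>2)) (dirac_S1 \<rho> w)"

definition D_plus ::
  "(real \<Rightarrow> real) \<Rightarrow> (real \<Rightarrow> real) \<Rightarrow> real \<Rightarrow> real \<Rightarrow> real \<Rightarrow> real \<Rightarrow> sect \<Rightarrow> sect" where
  "D_plus \<rho> f s t \<epsilon>1 \<epsilon>2 u = snd (perturbed_dirac \<rho> f s t \<epsilon>1 \<epsilon>2 (u, 0))"

definition D_minus ::
  "(real \<Rightarrow> real) \<Rightarrow> (real \<Rightarrow> real) \<Rightarrow> real \<Rightarrow> real \<Rightarrow> real \<Rightarrow> real \<Rightarrow> sect \<Rightarrow> sect" where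
  "D_minus \<rho> f s t \<epsilon>1 \<epsilon>2 v = fst (perturbed_dirac \<rho> f s t \<epsilon>1 \<epsilon>2 (0, v))"

lemmas dirac_defs = perturbed_dirac_def D_plus_def D_minus_def dirac_def dirac_S1_def
  clifford_muM_def clifford_dr_def clifford_dtheta_def mult_r_def mu_def nabla_r_def nabla_theta_def

lemma dirac_matrix:
  "dirac \<rho> (u, v) =
     (\<lambda>p. - partial_theta v p - \<i> * partial_r v p + 2 * of_real pi * \<i> * of_real (\<rho> (fst p)) * v p,
      \<lambda>p. partial_theta u p - \<i> * partial_r u p - 2 * of_real pi * \<i> * of_real (\<rho> (fst p)) * u p)"
  by (auto simp: dirac_defs fun_eq_iff algebra_simps)

lemma dirac_S1_matrix:
  "dirac_S1 \<rho> (u, v) =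
     (\<lambda>p. - partial_theta v p + 2 * of_real pi * \<i> * of_real (\<rho> (fst p)) * v p,
      \<lambda>p. partial_theta u p - 2 * of_real pi * \<i> * of_real (\<rho> (fst p)) * u p)"
  by (auto simp: dirac_defs fun_eq_iff algebra_simps)

lemma perturbed_dirac_off_diagonal:
  "perturbed_dirac \<rho> f s t \<epsilon>1 \<epsilon>2 (u, v) = (D_minus \<rho> f s t \<epsilon>1 \<epsilon>2 v, D_plus \<rho> f s t \<epsilon>1 \<epsilon>2 u)"
  by (auto simp: dirac_defs fun_eq_iff)

lemma D_plus_eq:
  "D_plus \<rho> f s t \<epsilon>1 \<epsilon>2 u =
     (\<lambda>p. (1 + of_real (t * f (fst p) powr \<epsilon>2))
            * (partial_theta u p - 2 * of_real pi * \<i> * of_real (\<rho> (fst p)) * u p)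
          - \<i> * partial_r u p
          - 2 * of_real pi * \<i> * of_real (s * f (fst p) powr \<epsilon>1 * \<rho> (fst p)) * u p)"
  by (auto simp: dirac_defs fun_eq_iff algebra_simps)

lemma D_minus_eq:
  "D_minus \<rho> f s t \<epsilon>1 \<epsilon>2 v =
     (\<lambda>p. - (1 + of_real (t * f (fst p) powr \<epsilon>2))
            * (partial_theta v p - 2 * of_real pi * \<i> * of_real (\<rho> (fst p)) * v p)
          - \<i> * partial_r v p
          + 2 * of_real pi * \<i> * of_real (s * f (fst p) powr \<epsilon>1 * \<rho> (fst p)) * v p)"
  by (auto simp: dirac_defs fun_eq_iff algebra_simps)


section \<open>The equivariant index\<close>

text \<open>The rotation action on sections.  Its direction is chosen such that \<open>a(r) e\<^bsup>2\<pi>in\<theta>\<^esup>\<close> has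
  weight \<open>n\<close>.  There is no action on the fibres.\<close>

definition rotate_section :: "real \<Rightarrow> sect \<Rightarrow> sect" where
  "rotate_section \<alpha> u = (\<lambda>(r, \<theta>). u (r, \<theta> + \<alpha>))"

definition weight_space :: "sect set \<Rightarrow> int \<Rightarrow> sect set" where
  "weight_space V n =
     {u \<in> V. \<forall>\<alpha>. rotate_section \<alpha> u = cscale (exp (2 * of_real pi * \<i> * of_int n * of_real \<alpha>)) u}"

text \<open>The representation ring \<open>R(S\<^sup>1)\<close> is free abelian on the classes of the irreducible
  representations \<open>\<complex>\<^sub>(\<^sub>n\<^sub>)\<close>, \<open>n \<in> \<int>\<close>.  The class of a finite-dimensional rotation-invariant space
  of sections is given by the multiplicities of its weights; on other spaces \<open>rep_class\<close> carries
  no meaning.\<close>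

type_synonym rep_ring = "int \<Rightarrow>\<^sub>0 int"

definition C_weight :: "int \<Rightarrow> rep_ring" where
  "C_weight n = Poly_Mapping.single n 1"

definition rep_class :: "sect set \<Rightarrow> rep_ring" where
  "rep_class V = Abs_poly_mapping (\<lambda>n. int (sect_space.dim (weight_space V n)))"

definition equivariant_L2_index :: "(sect \<Rightarrow> sect) \<Rightarrow> (sect \<Rightarrow> sect) \<Rightarrow> rep_ring" where
  "equivariant_L2_index P Q = rep_class (ker_L2 P) - rep_class (ker_L2 Q)"

text \<open>The value of the index for all sufficiently large \<open>t\<close>.\<close>

definition local_RR :: "(real \<Rightarrow> real) \<Rightarrow> (real \<Rightarrow> real) \<Rightarrow> real \<Rightarrow> rep_ring" where
  "local_RR \<rho> f \<epsilon>1 =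
     (THE R. \<forall>\<^sub>F t in at_top.
        equivariant_L2_index (D_plus \<rho> f 0 t \<epsilon>1 0) (D_minus \<rho> f 0 t \<epsilon>1 0) = R)"

lemma primitive_exists:
  fixes h :: "real \<Rightarrow> real"
  assumes "continuous_on UNIV h"
  shows "\<exists>A. \<forall>r. (A has_real_derivative h r) (at r)"
  using einterval_antiderivative[of "-\<infinity>" \<infinity> h] assms
  by (auto simp: continuous_on_eq_continuous_at has_real_derivative_iff_has_vector_derivative)

end

(* The Fourier coefficients a_n(r) of a kernel section satisfy
   a_n' = 2 pi k (n - rho) a_n with k = 1 + t for D^+ and k = -(1 + t) for D^-.  Since rho is
   m - 1/2 near -infinity and m + 1/2 near +infinity, a nonzero a_n is bounded away from 0 on
   one of the two ends, hence not square integrable, except when k > 0 and n = m.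
   Completeness of the Fourier characters then determines the kernel. *)
theory Submission
  imports Defs
begin

section \<open>Fourier coefficients of periodic functions\<close>

text \<open>The half-integer end values of \<rho> decide every weight: \<open>n - \<rho>\<close>
  equals n - m + 1/2 on the left end and n - m - 1/2 on the right end, and neither vanishes for an
  integer n. For n \<noteq> m the two values have the same sign, so a_n grows outwards at one end
  whatever the sign of k. For n = m they are 1/2 and -1/2, so a_m decays at both ends if k > 0 and
  grows at both if k < 0.

  Coefficients meet the L2 condition through a Bessel bound with one term: |a_n(r)|^2 is at most the
  energy of u on the circle over r, and that energy is integrable in r by Fubini.

  Convergence of Fourier series is never discussed. Completeness means only that a continuous
  periodic function with vanishing coefficients is zero. It is obtained by approximating the
  conjugate function by polynomials in the real coordinates of the circle, and two sections are then
  compared circle by circle.\<close>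

definition fourier_char :: "int \<Rightarrow> real \<Rightarrow> complex" where
  "fourier_char n \<theta> = exp (2 * of_real pi * \<i> * of_int n * of_real \<theta>)"

lemma fourier_char_cis: "fourier_char n \<theta> = cis (2 * pi * n * \<theta>)"
  unfolding fourier_char_def cis_conv_exp by (rule arg_cong[of _ _ exp]) (simp add: mult_ac)

lemma fourier_char_0 [simp]: "fourier_char 0 \<theta> = 1"
  by (simp add: fourier_char_def)

lemma norm_fourier_char [simp]: "norm (fourier_char n \<theta>) = 1"
  by (simp add: fourier_char_cis)

lemma fourier_char_add: "fourier_char n (x + y) = fourier_char n x * fourier_char n y"
  by (simp add: fourier_char_def exp_add algebra_simps)

lemma fourier_char_mult: "fourier_char n x * fourier_char k x = fourier_char (n + k) x"
  by (simp add: fourier_char_def exp_add algebra_simps)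

lemma fourier_char_1 [simp]: "fourier_char n 1 = 1"
  by (simp add: fourier_char_cis cis_multiple_2pi)

lemma fourier_char_zero_right [simp]: "fourier_char n 0 = 1"
  by (simp add: fourier_char_def)

lemma fourier_char_periodic [simp]: "fourier_char n (x + 1) = fourier_char n x"
  by (simp add: fourier_char_add)

lemma continuous_on_fourier_char [continuous_intros]:
  "continuous_on S f \<Longrightarrow> continuous_on S (\<lambda>x. fourier_char n (f x))"
  unfolding fourier_char_def by (intro continuous_intros)

lemma has_vector_derivative_fourier_char:
  "(fourier_char n has_vector_derivative 2 * of_real pi * \<i> * of_int n * fourier_char n x) (at x within S)"
  unfolding fourier_char_def
  by (auto intro!: derivative_eq_intros has_vector_derivative_real_field)

lemma Re_fourier_char_1: "of_real (Re (fourier_char 1 x)) = (fourier_char 1 x + fourier_char (-1) x) / 2"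
  and Im_fourier_char_1: "of_real (Im (fourier_char 1 x)) = (fourier_char 1 x - fourier_char (-1) x) / (2 * \<i>)"
  by (simp_all add: fourier_char_cis complex_eq_iff)

text \<open>A gauge integral over the closed interval: all integrands are continuous there, so
  integrability is immediate and the Leibniz rule and the fundamental theorem apply. The comparison
  with the Lebesgue integral over [0,1) is left to
  \<open>square_integrable_fibre_energy\<close>.\<close>

definition fourier_coeff :: "(real \<Rightarrow> complex) \<Rightarrow> int \<Rightarrow> complex" where
  "fourier_coeff g n = integral {0..1} (\<lambda>x. fourier_char (- n) x * g x)"

lemma continuous_on_polynomial_fourier_char:
  fixes p :: "complex \<Rightarrow> 'b::euclidean_space"
  shows "polynomial_function p \<Longrightarrow> continuous_on S (\<lambda>x. p (fourier_char n x))"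
  by (rule continuous_on_compose2[where g = p and t = UNIV])
     (auto intro: continuous_on_polymonial_function continuous_intros)

text \<open>Stating this for all \<open>n\<close> makes products immediate in the induction; multiplying by a linear
  function of the circle point only shifts the index by one.\<close>

lemma fourier_annihilator_polynomial:
  fixes q :: "complex \<Rightarrow> real"
  assumes "real_polynomial_function q" "continuous_on {0..1} g" "\<And>n. fourier_coeff g n = 0"
  shows "fourier_coeff (\<lambda>x. g x * of_real (q (fourier_char 1 x))) n = 0"
  using assms
proof (induction q arbitrary: g n rule: real_polynomial_function.induct)
  case (linear q)
  interpret bounded_linear q by fact
  have q: "q z = Re z * q 1 + Im z * q \<i>" for z
    using add[of "Re z *\<^sub>R 1" "Im z *\<^sub>R \<i>"] scaleR[of "Re z" 1] scaleR[of "Im z" \<i>]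
    by (simp add: scaleR_conv_of_real complex_eq[symmetric] mult.commute)
  \<comment> \<open>A real-linear form is q(1) cos + q(\<i>) sin on the circle; these are its
    coefficients after writing cosine and sine through the characters of index 1 and -1.\<close>
  define \<alpha> \<beta> where "\<alpha> = (of_real (q 1) / 2 + of_real (q \<i>) / (2 * \<i>) :: complex)"
    and "\<beta> = (of_real (q 1) / 2 - of_real (q \<i>) / (2 * \<i>) :: complex)"
  have "of_real (q (fourier_char 1 x)) = \<alpha> * fourier_char 1 x + \<beta> * fourier_char (-1) x" for x
    unfolding q[of "fourier_char 1 x"] of_real_add of_real_mult Re_fourier_char_1 Im_fourier_char_1
    by (simp add: \<alpha>_def \<beta>_def field_simps)
  then have "fourier_coeff (\<lambda>x. g x * of_real (q (fourier_char 1 x))) n =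
     integral {0..1} (\<lambda>x. \<alpha> * (fourier_char (-(n - 1)) x * g x) + \<beta> * (fourier_char (-(n + 1)) x * g x))"
    unfolding fourier_coeff_def
    using fourier_char_mult[of "-n" _ 1] fourier_char_mult[of "-n" _ "-1"]
    by (intro arg_cong[of _ _ "integral _"] ext) (simp add: algebra_simps)
  also have "\<dots> = \<alpha> * fourier_coeff g (n - 1) + \<beta> * fourier_coeff g (n + 1)"
    unfolding fourier_coeff_def
    by (subst integral_add)
       (auto intro!: integrable_continuous_interval continuous_intros linear.prems)
  finally show ?case by (simp add: linear.prems)
next
  case (const c)
  have "fourier_coeff (\<lambda>x. g x * of_real c) n = fourier_coeff g n * of_real c"
    unfolding fourier_coeff_def by (simp add: mult.assoc[symmetric])
  then show ?case by (simp add: const.prems)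
next
  case (add q1 q2)
  have q: "continuous_on {0..1} (\<lambda>x. complex_of_real (q (fourier_char 1 x)))"
    if "polynomial_function q" for q :: "complex \<Rightarrow> real"
    using that by (intro continuous_on_of_real continuous_on_polynomial_fourier_char)
  have "fourier_coeff (\<lambda>x. g x * of_real (q1 (fourier_char 1 x) + q2 (fourier_char 1 x))) n =
     fourier_coeff (\<lambda>x. g x * of_real (q1 (fourier_char 1 x))) n
     + fourier_coeff (\<lambda>x. g x * of_real (q2 (fourier_char 1 x))) n"
    unfolding fourier_coeff_def
    by (subst integral_add[symmetric])
       (auto simp: algebra_simps intro!: integrable_continuous_interval continuous_intros add.prems
        q add.hyps[unfolded real_polynomial_function_eq])
  then show ?case using add by simp
next
  case (mult q1 q2)
  have q: "continuous_on {0..1} (\<lambda>x. complex_of_real (q (fourier_char 1 x)))"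
    if "polynomial_function q" for q :: "complex \<Rightarrow> real"
    using that by (intro continuous_on_of_real continuous_on_polynomial_fourier_char)
  \<comment> \<open>The hypothesis for \<open>q2\<close> is applied to g times \<open>q1\<close>,
    all of whose coefficients vanish by the hypothesis for \<open>q1\<close>. Hence g must vary in
    the induction.\<close>
  have "fourier_coeff (\<lambda>x. (g x * of_real (q1 (fourier_char 1 x))) * of_real (q2 (fourier_char 1 x))) n = 0"
    by (rule mult.IH(2)) (auto intro!: mult.IH(1) continuous_intros mult.prems
        q mult.hyps[unfolded real_polynomial_function_eq])
  then show ?case by (simp add: mult.assoc)
qed

text \<open>A continuous surjection from a compact space onto a Hausdorff space is a quotient map,
  and winding [0,1] around the circle identifies only the two endpoints. This moves g to a compact
  subset of the plane, where Stone-Weierstrass applies.\<close>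

lemma periodic_factors_through_circle:
  fixes g :: "real \<Rightarrow> complex"
  assumes "continuous_on {0..1} g" "g 0 = g 1"
  shows "\<exists>h. continuous_on (sphere 0 1) h \<and> (\<forall>x\<in>{0..1}. h (fourier_char 1 x) = g x)"
proof -
  have img: "fourier_char 1 ` {0..1} = sphere 0 1"
  proof (intro equalityI subsetI)
    fix z :: complex assume "z \<in> sphere 0 1"
    then have "z = fourier_char 1 (Arg2pi z / (2 * pi))"
      by (simp add: fourier_char_cis cis_conv_exp complex_norm_eq_1_exp mult.commute)
    moreover have "Arg2pi z / (2 * pi) \<in> {0..1}"
      using Arg2pi_ge_0[of z] Arg2pi_lt_2pi[of z] by (simp add: field_simps)
    ultimately show "z \<in> fourier_char 1 ` {0..1}" by blast
  qed auto
  have inj: "g x = g y" if "x \<in> {0..1}" "y \<in> {0..1}" "fourier_char 1 x = fourier_char 1 y" for x y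
  proof -
    note xy = that
    obtain k :: int where "2 * pi * x = 2 * pi * y + 2 * pi * k"
      proof -
      obtain k :: int where "2 * of_real pi * \<i> * of_int 1 * of_real x
          = 2 * of_real pi * \<i> * of_int 1 * of_real y + of_real (of_int (2 * k) * pi) * \<i>"
        using xy(3) unfolding fourier_char_def exp_eq by blast
      from arg_cong[OF this, of Im] show ?thesis by (intro that[of k]) simp
    qed
    then have k: "x - y = k" by (simp flip: distrib_left)
    \<comment> \<open>Two points of [0,1] with a nonzero integer difference are the endpoints, where
      g agrees by hypothesis.\<close>
    have "k = 0 \<or> k = -1 \<or> k = 1" using k xy(1,2) by auto
    then have "x = y \<or> x = 0 \<and> y = 1 \<or> x = 1 \<and> y = 0" using k xy(1,2) by auto
    then show ?thesis using assms(2) by auto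
  qed
  have q: "quotient_map (top_of_set {0..1}) (top_of_set (sphere 0 1)) (fourier_char 1)"
    by (rule T1_Spaces.continuous_imp_quotient_map)
       (use img in \<open>auto simp: compact_space_subtopology Hausdorff_space_subtopology
          intro!: continuous_intros\<close>)
  have g: "continuous_map (top_of_set {0..1}) euclidean g"
    using assms(1) by simp
  show ?thesis
  proof (rule quotient_map_lift_exists[OF q g])
    show "g x = g y" if "x \<in> topspace (top_of_set {0..1})" "y \<in> topspace (top_of_set {0..1})"
      "fourier_char 1 x = fourier_char 1 y" for x y
      using that by (intro inj) simp_all
  next
    fix h assume "continuous_map (top_of_set (sphere 0 1)) euclidean h"
      and "\<And>x. x \<in> topspace (top_of_set {0..1}) \<Longrightarrow> h (fourier_char 1 x) = g x"
    then show ?thesis by (intro exI[of _ h]) simp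
  qed
qed

text \<open>If p approximates the conjugate of g within e on the circle and g is orthogonal to p,
  then the integral of |g|^2 equals that of g times the error, hence is at most e times the integral
  of |g|. Letting e tend to 0 gives zero energy.\<close>

lemma fourier_unique:
  fixes g :: "real \<Rightarrow> complex"
  assumes g: "continuous_on {0..1} g" "g 0 = g 1" and coeff: "\<And>n. fourier_coeff g n = 0"
    and "x \<in> {0..1}"
  shows "g x = 0"
proof -
  let ?N = "integral {0..1} (\<lambda>x. (norm (g x))\<^sup>2)"
  obtain h where h: "continuous_on (sphere 0 1) h" "\<And>x. x \<in> {0..1} \<Longrightarrow> h (fourier_char 1 x) = g x"
    using periodic_factors_through_circle[OF g] by blast
  \<comment> \<open>\<open>g\<close> annihilates polynomials on the circle, which approximate its own conjugate.\<close>
  have small: "?N \<le> e * integral {0..1} (\<lambda>x. norm (g x))" if "e > 0" for e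
  proof -
    have "\<exists>p. polynomial_function p \<and> (\<forall>z\<in>sphere 0 1. norm (cnj (h z) - p z) < e)"
      by (intro Stone_Weierstrass_polynomial_function compact_sphere continuous_on_cnj h(1) that)
    then obtain p where p: "polynomial_function p" "\<And>z. z \<in> sphere 0 1 \<Longrightarrow> norm (cnj (h z) - p z) < e"
      by blast
    let ?p = "\<lambda>x. p (fourier_char 1 x)"
    have Re_p: "real_polynomial_function (\<lambda>z. Re (p z))" and Im_p: "real_polynomial_function (\<lambda>z. Im (p z))"
      using p(1) bounded_linear_Re bounded_linear_Im unfolding polynomial_function_def o_def by blast+
    note cp = continuous_on_polynomial_fourier_char[OF p(1)]
    have "g x * ?p x = g x * of_real (Re (?p x)) + \<i> * (g x * of_real (Im (?p x)))" for x
      by (subst complex_eq[of "?p x"]) (simp add: algebra_simps)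
    then have "integral {0..1} (\<lambda>x. g x * ?p x)
        = integral {0..1} (\<lambda>x. g x * of_real (Re (?p x)) + \<i> * (g x * of_real (Im (?p x))))"
      by presburger
    also have "\<dots> = fourier_coeff (\<lambda>x. g x * of_real (Re (?p x))) 0
        + \<i> * fourier_coeff (\<lambda>x. g x * of_real (Im (?p x))) 0"
      unfolding fourier_coeff_def
      by (subst integral_add) (auto intro!: integrable_continuous_interval continuous_intros g cp)
    also have "\<dots> = 0"
      using fourier_annihilator_polynomial[OF Re_p g(1) coeff] fourier_annihilator_polynomial[OF Im_p g(1) coeff]
      by simp
    finally have p0: "integral {0..1} (\<lambda>x. g x * ?p x) = 0" .
    have "of_real ?N = integral {0..1} (\<lambda>x. complex_of_real ((norm (g x))\<^sup>2))"
      by (intro integral_linear[OF _ bounded_linear_of_real, unfolded o_def, symmetric]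
          integrable_continuous_interval continuous_intros g)
    also have "\<dots> = integral {0..1} (\<lambda>x. g x * cnj (g x)) - integral {0..1} (\<lambda>x. g x * ?p x)"
      by (simp add: p0 complex_norm_square[symmetric])
    also have "\<dots> = integral {0..1} (\<lambda>x. g x * (cnj (g x) - ?p x))"
      by (subst integral_diff[symmetric])
         (auto intro!: integrable_continuous_interval continuous_intros g cp simp: algebra_simps)
    finally have *: "complex_of_real ?N = integral {0..1} (\<lambda>x. g x * (cnj (g x) - ?p x))" .
    have "?N \<le> norm (complex_of_real ?N)" by simp
    also have "\<dots> \<le> integral {0..1} (\<lambda>x. e * norm (g x))"
      unfolding *
    proof (rule integral_norm_bound_integral)
      fix x :: real assume x: "x \<in> {0..1}"
      have "norm (g x) * norm (cnj (g x) - ?p x) \<le> norm (g x) * e"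
        using p(2)[of "fourier_char 1 x"] h(2)[OF x] by (intro mult_left_mono) auto
      then show "norm (g x * (cnj (g x) - ?p x)) \<le> e * norm (g x)" by (simp add: norm_mult mult.commute)
    qed (auto intro!: integrable_continuous_interval continuous_intros g cp)
    finally show ?thesis by simp
  qed
  have "?N \<le> 0"
  proof (rule field_le_epsilon)
    fix e :: real assume e: "e > 0"
    define I where "I = integral {0..1} (\<lambda>x. norm (g x))"
    have I: "I \<ge> 0" unfolding I_def by (intro integral_nonneg integrable_continuous_interval continuous_intros g) auto
    \<comment> \<open>The summand 1 keeps the quotient meaningful when I = 0.\<close>
    have "?N \<le> e / (I + 1) * I" using small[of "e / (I + 1)"] e I unfolding I_def by simp
    also have "\<dots> \<le> e" using e I by (simp add: field_simps)
    finally show "?N \<le> 0 + e" by simp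
  qed
  moreover have "?N \<ge> 0" by (intro integral_nonneg integrable_continuous_interval continuous_intros g) auto
  ultimately have "?N = 0" by simp
  then have "\<forall>x\<in>{0..1}. (norm (g x))\<^sup>2 = 0"
    by (subst (asm) integral_eq_0_iff) (auto intro!: continuous_intros g)
  then show ?thesis using \<open>x \<in> {0..1}\<close> by simp
qed

section \<open>Smoothness of Fourier sections\<close>

text \<open>\<open>Ck\<close> asks for continuity only at the last level; below it, continuity comes
  from differentiability. The product rule needs this, since it leaves undifferentiated factors that
  must be available one order lower.\<close>

lemma Ck_pred: "Ck (Suc k) f \<Longrightarrow> Ck k f"
proof (induction k arbitrary: f)
  case 0
  then show ?case
    by (simp add: continuous_on_eq_continuous_at differentiable_imp_continuous_within)
next
  case (Suc k)
  from Suc.prems have "\<forall>x. f differentiable (at x)"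
    and "Ck (Suc k) (\<lambda>x. frechet_derivative f (at x) v)" for v
    unfolding Ck.simps(2)[of "Suc k"] by blast+
  with Suc.IH show ?case unfolding Ck.simps(2)[of k] by blast
qed

lemma Ck_add: "Ck k f \<Longrightarrow> Ck k g \<Longrightarrow> Ck k (\<lambda>x. f x + g x)"
proof (induction k arbitrary: f g)
  case (Suc k)
  have "frechet_derivative (\<lambda>x. f x + g x) (at x) = (\<lambda>v. frechet_derivative f (at x) v + frechet_derivative g (at x) v)" for x
    using Suc.prems
    by (intro frechet_derivative_at[symmetric] has_derivative_add) (auto simp: frechet_derivative_works[symmetric])
  then show ?case using Suc by auto
qed (simp add: continuous_on_add)

lemma Ck_mult:
  fixes f g :: "'a::real_normed_vector \<Rightarrow> 'b::real_normed_algebra"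
  shows "Ck k f \<Longrightarrow> Ck k g \<Longrightarrow> Ck k (\<lambda>x. f x * g x)"
proof (induction k arbitrary: f g)
  case (Suc k)
  have "frechet_derivative (\<lambda>x. f x * g x) (at x) =
      (\<lambda>v. f x * frechet_derivative g (at x) v + frechet_derivative f (at x) v * g x)" for x
    using Suc.prems
    by (intro frechet_derivative_at[symmetric] has_derivative_mult) (auto simp: frechet_derivative_works[symmetric])
  then show ?case
    using Suc Ck_pred[OF Suc.prems(1)] Ck_pred[OF Suc.prems(2)] by (auto intro!: Ck_add)
qed (simp add: continuous_on_mult)

text \<open>This is the shape of the logarithmic directional derivative of a Fourier section. The
  constant \<open>d\<close> varies in the induction because differentiation turns it into 0.\<close>

lemma Ck_affine_of_fst:
  fixes h :: "real \<Rightarrow> real"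
  shows "Ck k h \<Longrightarrow> Ck k (\<lambda>p :: real \<times> real. complex_of_real (h (fst p)) * c + d)"
proof (induction k arbitrary: h d)
  case 0
  then show ?case
    by (auto intro!: continuous_intros continuous_on_compose2[of UNIV h])
next
  case (Suc k)
  have "((\<lambda>p :: real \<times> real. complex_of_real (h (fst p)) * c + d) has_derivative
     (\<lambda>v. complex_of_real (frechet_derivative h (at (fst p)) (fst v)) * c)) (at p)" for p
  proof -
    have "(h has_derivative frechet_derivative h (at (fst p))) (at (fst p))"
      using Suc.prems by (auto simp: frechet_derivative_works[symmetric])
    from has_derivative_compose[OF has_derivative_fst[OF has_derivative_ident] this]
    show ?thesis by (auto intro!: derivative_eq_intros)
  qed
  note der = this
  then have eq: "frechet_derivative (\<lambda>p :: real \<times> real. complex_of_real (h (fst p)) * c + d) (at p) =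
     (\<lambda>v. complex_of_real (frechet_derivative h (at (fst p)) (fst v)) * c)" for p
    by (metis frechet_derivative_at)
  have "Ck k (\<lambda>p :: real \<times> real. complex_of_real (frechet_derivative h (at (fst p)) (fst v)) * c + 0)" for v :: "real \<times> real"
    by (rule Suc.IH) (use Suc.prems in auto)
  moreover have "(\<lambda>p :: real \<times> real. complex_of_real (h (fst p)) * c + d) differentiable (at p)" for p
    using der differentiableI by blast
  ultimately show ?case unfolding Ck.simps eq by simp
qed

text \<open>Radial and angular factors merge into one complex exponential, so the derivative is the
  section times the derivative of the exponent.\<close>

lemma has_derivative_fourier_section:
  assumes "\<And>r. (B has_real_derivative h r) (at r)"
  shows "(fourier_section (\<lambda>r. exp (B r)) n has_derivative
     (\<lambda>v. fourier_section (\<lambda>r. exp (B r)) n p *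
        (complex_of_real (h (fst p)) * of_real (fst v) + 2 * of_real pi * \<i> * of_int n * of_real (snd v)))) (at p)"
proof -
  have B: "((\<lambda>p. B (fst p)) has_derivative (\<lambda>v. h (fst p) * fst v)) (at p)"
    using has_derivative_compose[OF has_derivative_fst[OF has_derivative_ident]
        assms[of "fst p", unfolded has_field_derivative_def]] by simp
  have eq: "fourier_section (\<lambda>r. exp (B r)) n =
      (\<lambda>p. exp (of_real (B (fst p)) + 2 * of_real pi * \<i> * of_int n * of_real (snd p)))"
    by (auto simp: fourier_section_def fun_eq_iff exp_add exp_of_real split_beta)
  have "((\<lambda>p. complex_of_real (B (fst p)) + 2 * of_real pi * \<i> * of_int n * of_real (snd p)) has_derivative
      (\<lambda>v. complex_of_real (h (fst p) * fst v) + 2 * of_real pi * \<i> * of_int n * of_real (snd v))) (at p)"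
    by (intro has_derivative_add has_derivative_of_real B has_derivative_mult_right has_derivative_snd has_derivative_ident)
  from has_derivative_compose[OF this DERIV_exp[unfolded has_field_derivative_def]]
  show ?thesis unfolding eq by (simp add: algebra_simps)
qed

text \<open>Bootstrapping: each directional derivative is the section itself times a smooth function
  of r, so class \<open>Ck k\<close> of the section yields class \<open>Ck (Suc k)\<close>.\<close>

lemma smooth_section_fourier_section:
  assumes B: "\<And>r. (B has_real_derivative h r) (at r)" and h: "smooth h"
  shows "smooth_section (fourier_section (\<lambda>r. exp (B r)) n)" (is "smooth_section ?u")
proof -
  note D = has_derivative_fourier_section[OF B, of n]
  have eq: "frechet_derivative ?u (at p) = (\<lambda>v. ?u p *
        (complex_of_real (h (fst p)) * of_real (fst v) + 2 * of_real pi * \<i> * of_int n * of_real (snd v)))" for p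
    by (rule frechet_derivative_at[OF D, symmetric])
  have "Ck k ?u" for k
  proof (induction k)
    case 0
    show ?case
      using has_derivative_continuous[OF D] by (simp add: continuous_on_eq_continuous_at)
  next
    case (Suc k)
    have "?u differentiable (at p)" for p
      using D differentiableI by blast
    moreover have "Ck k (\<lambda>p :: real \<times> real. complex_of_real (h (fst p)) * c + d)" for c d
      using h by (intro Ck_affine_of_fst) (simp add: smooth_def)
    ultimately show ?case unfolding Ck.simps eq
      using Suc by (intro conjI allI Ck_mult)
  qed
  moreover have "?u (r, \<theta> + 1) = ?u (r, \<theta>)" for r \<theta>
    using fourier_char_periodic[of n \<theta>] by (simp add: fourier_section_def fourier_char_def)
  ultimately show ?thesis by (auto simp: smooth_section_def smooth_def)
qed

section \<open>The differential equation for the Fourier coefficients\<close>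

lemma smooth_section_has_derivative:
  assumes "smooth_section u"
  shows "(u has_derivative frechet_derivative u (at p)) (at p)"
proof -
  have "Ck (Suc 0) u" using assms by (simp only: smooth_section_def smooth_def)
  then have "u differentiable (at p)" unfolding Ck.simps by blast
  then show ?thesis by (simp only: frechet_derivative_works)
qed

lemma smooth_section_continuous:
  assumes "smooth_section u"
  shows "continuous_on S u"
proof -
  have "Ck 0 u" using assms by (simp only: smooth_section_def smooth_def)
  then show ?thesis by (auto intro: continuous_on_subset)
qed

lemma smooth_section_continuous_partials:
  assumes "smooth_section u"
  shows "continuous_on S (partial_r u)" "continuous_on S (partial_theta u)"
proof -
  have "Ck (Suc 0) u" using assms by (simp only: smooth_section_def smooth_def)
  then show "continuous_on S (partial_r u)" "continuous_on S (partial_theta u)"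
    unfolding partial_r_def partial_theta_def Ck.simps by (blast intro: continuous_on_subset)+
qed

lemma smooth_section_periodic:
  assumes "smooth_section u"
  shows "u (r, 1) = u (r, 0)"
proof -
  have "u (r, 0 + 1) = u (r, 0)" using assms unfolding smooth_section_def by blast
  then show ?thesis by simp
qed

lemma has_vector_derivative_partial_r:
  assumes "smooth_section u"
  shows "((\<lambda>r. u (r, \<theta>)) has_vector_derivative partial_r u (r, \<theta>)) (at r within S)"
proof -
  note D = smooth_section_has_derivative[OF assms, of "(r, \<theta>)"]
  interpret linear "frechet_derivative u (at (r, \<theta>))"
    using D by (rule has_derivative_linear)
  have "((\<lambda>r. u (r, \<theta>)) has_derivative (\<lambda>v. frechet_derivative u (at (r, \<theta>)) (v, 0))) (at r within S)"
    by (rule has_derivative_compose[OF has_derivative_Pair[OF has_derivative_ident has_derivative_const] D])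
  moreover have "frechet_derivative u (at (r, \<theta>)) (v, 0) = v *\<^sub>R partial_r u (r, \<theta>)" for v
    using scale[of v "(1, 0)"] by (simp add: partial_r_def)
  ultimately show ?thesis by (simp add: has_vector_derivative_def)
qed

lemma has_vector_derivative_partial_theta:
  assumes "smooth_section u"
  shows "((\<lambda>\<theta>. u (r, \<theta>)) has_vector_derivative partial_theta u (r, \<theta>)) (at \<theta> within S)"
proof -
  note D = smooth_section_has_derivative[OF assms, of "(r, \<theta>)"]
  interpret linear "frechet_derivative u (at (r, \<theta>))"
    using D by (rule has_derivative_linear)
  have "((\<lambda>\<theta>. u (r, \<theta>)) has_derivative (\<lambda>v. frechet_derivative u (at (r, \<theta>)) (0, v))) (at \<theta> within S)"
    by (rule has_derivative_compose[OF has_derivative_Pair[OF has_derivative_const has_derivative_ident] D])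
  moreover have "frechet_derivative u (at (r, \<theta>)) (0, v) = v *\<^sub>R partial_theta u (r, \<theta>)" for v
    using scale[of v "(0, 1)"] by (simp add: partial_theta_def)
  ultimately show ?thesis by (simp add: has_vector_derivative_def)
qed

lemma continuous_on_slice: "continuous_on UNIV u \<Longrightarrow> continuous_on S (\<lambda>\<theta>. u (r, \<theta>))"
  by (rule continuous_on_compose2[where g = u and t = UNIV])
     (simp_all add: continuous_on_Pair)

lemma continuous_on_slices:
  assumes "smooth_section u"
  shows "continuous_on S (\<lambda>\<theta>. u (r, \<theta>))" "continuous_on S (\<lambda>\<theta>. partial_r u (r, \<theta>))"
    "continuous_on S (\<lambda>\<theta>. partial_theta u (r, \<theta>))"
  by (intro continuous_on_slice smooth_section_continuous smooth_section_continuous_partials assms)+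

lemma has_vector_derivative_fourier_coeff:
  assumes "smooth_section u"
  shows "((\<lambda>r. fourier_coeff (\<lambda>\<theta>. u (r, \<theta>)) n) has_vector_derivative
           fourier_coeff (\<lambda>\<theta>. partial_r u (r, \<theta>)) n) (at r)"
  unfolding fourier_coeff_def interval_cbox
proof (rule leibniz_rule_vector_derivative[where U = UNIV])
  show "((\<lambda>r. fourier_char (- n) \<theta> * u (r, \<theta>)) has_vector_derivative
      fourier_char (- n) \<theta> * partial_r u (r, \<theta>)) (at r within UNIV)" for r \<theta>
    by (intro has_vector_derivative_mult_right has_vector_derivative_partial_r assms)
  show "(\<lambda>\<theta>. fourier_char (- n) \<theta> * u (r, \<theta>)) integrable_on cbox 0 1" for r
    by (intro integrable_continuous continuous_intros continuous_on_slices assms)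
  have "continuous_on (UNIV \<times> cbox 0 1) (\<lambda>p. fourier_char (- n) (snd p) * partial_r u p)"
    by (intro continuous_intros smooth_section_continuous_partials assms)
  then show "continuous_on (UNIV \<times> cbox 0 1) (\<lambda>(r, \<theta>). fourier_char (- n) \<theta> * partial_r u (r, \<theta>))"
    by (simp add: split_beta)
qed auto

text \<open>Integration by parts; the boundary terms cancel because both the section and the
  character are 1-periodic.\<close>

lemma fourier_coeff_partial_theta:
  assumes "smooth_section u"
  shows "fourier_coeff (\<lambda>\<theta>. partial_theta u (r, \<theta>)) n
    = 2 * of_real pi * \<i> * of_int n * fourier_coeff (\<lambda>\<theta>. u (r, \<theta>)) n"
proof -
  let ?e = "fourier_char (- n)"
  have "((\<lambda>\<theta>. ?e \<theta> * partial_theta u (r, \<theta>) + 2 * of_real pi * \<i> * of_int (- n) * ?e \<theta> * u (r, \<theta>))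
      has_integral ?e 1 * u (r, 1) - ?e 0 * u (r, 0)) {0..1}"
    by (intro fundamental_theorem_of_calculus has_vector_derivative_mult
        has_vector_derivative_fourier_char has_vector_derivative_partial_theta assms) simp
  then have "integral {0..1} (\<lambda>\<theta>. ?e \<theta> * partial_theta u (r, \<theta>)
      + 2 * of_real pi * \<i> * of_int (- n) * (?e \<theta> * u (r, \<theta>))) = 0"
    using smooth_section_periodic[OF assms] by (simp add: integral_unique mult.assoc)
  then have "fourier_coeff (\<lambda>\<theta>. partial_theta u (r, \<theta>)) n
      + 2 * of_real pi * \<i> * of_int (- n) * fourier_coeff (\<lambda>\<theta>. u (r, \<theta>)) n = 0"
    unfolding fourier_coeff_def integral_mult_right[symmetric]
    by (subst integral_add[symmetric])
       (intro integrable_continuous_interval continuous_intros continuous_on_slices assms)+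
  then show ?thesis by (simp add: add_eq_0_iff2)
qed

text \<open>The hypothesis is the kernel equation solved for the radial derivative. The values 1 + t
  and -(1 + t) of \<kappa> give the two chiral operators, so one computation serves both.\<close>

lemma fourier_coeff_ode:
  assumes u: "smooth_section u"
    and pde: "\<And>p. partial_r u p
      = - \<i> * of_real \<kappa> * (partial_theta u p - 2 * of_real pi * \<i> * of_real (\<rho> (fst p)) * u p)"
  shows "((\<lambda>r. fourier_coeff (\<lambda>\<theta>. u (r, \<theta>)) n) has_vector_derivative
           of_real (2 * pi * \<kappa> * (n - \<rho> r)) * fourier_coeff (\<lambda>\<theta>. u (r, \<theta>)) n) (at r)"
proof -
  let ?e = "fourier_char (- n)" and ?c = "2 * of_real pi * of_real \<kappa> * of_real (\<rho> r) :: complex"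
  have "?e \<theta> * partial_r u (r, \<theta>)
      = - \<i> * of_real \<kappa> * (?e \<theta> * partial_theta u (r, \<theta>)) - ?c * (?e \<theta> * u (r, \<theta>))" for \<theta>
    using pde[of "(r, \<theta>)", unfolded fst_conv] i_squared by algebra
  then have "fourier_coeff (\<lambda>\<theta>. partial_r u (r, \<theta>)) n
      = integral {0..1} (\<lambda>\<theta>. - \<i> * of_real \<kappa> * (?e \<theta> * partial_theta u (r, \<theta>)) - ?c * (?e \<theta> * u (r, \<theta>)))"
    by (simp only: fourier_coeff_def)
  also have "\<dots> = integral {0..1} (\<lambda>\<theta>. - \<i> * of_real \<kappa> * (?e \<theta> * partial_theta u (r, \<theta>)))
      - integral {0..1} (\<lambda>\<theta>. ?c * (?e \<theta> * u (r, \<theta>)))"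
    by (intro integral_diff integrable_continuous_interval continuous_intros continuous_on_slices u)
  also have "\<dots> = - \<i> * of_real \<kappa> * fourier_coeff (\<lambda>\<theta>. partial_theta u (r, \<theta>)) n
      - ?c * fourier_coeff (\<lambda>\<theta>. u (r, \<theta>)) n"
    by (simp only: fourier_coeff_def integral_mult_right)
  also have "\<dots> = of_real (2 * pi * \<kappa> * (n - \<rho> r)) * fourier_coeff (\<lambda>\<theta>. u (r, \<theta>)) n"
    unfolding fourier_coeff_partial_theta[OF u] of_real_mult of_real_diff of_real_of_int_eq of_real_numeral
    using i_squared by algebra
  finally show ?thesis using has_vector_derivative_fourier_coeff[OF u, of n r] by simp
qed

text \<open>The integrating factor exp(-H) turns a into a function with zero derivative on the
  line.\<close>

lemma linear_ode_solution:
  fixes a :: "real \<Rightarrow> complex"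
  assumes a: "\<And>r. (a has_vector_derivative of_real (h r) * a r) (at r)"
    and H: "\<And>r. (H has_real_derivative h r) (at r)"
  obtains c where "\<And>r. a r = c * of_real (exp (H r))"
proof -
  have "((\<lambda>r. of_real (exp (- H r)) * a r) has_vector_derivative 0) (at r within UNIV)" for r
  proof -
    have "((\<lambda>r. exp (- H r)) has_real_derivative - h r * exp (- H r)) (at r)"
      by (auto intro!: derivative_eq_intros H)
    then have "((\<lambda>r. of_real (exp (- H r)) :: complex) has_vector_derivative of_real (- h r * exp (- H r))) (at r)"
      by (intro has_vector_derivative_of_real) (simp add: has_real_derivative_iff_has_vector_derivative)
    from has_vector_derivative_mult[OF this a] show ?thesis by (simp add: algebra_simps)
  qed
  then obtain c where c: "\<And>r. of_real (exp (- H r)) * a r = c"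
    by (rule has_vector_derivative_zero_constant[OF convex_UNIV]) auto
  have "a r = c * of_real (exp (H r))" for r
    unfolding c[of r, symmetric] by (simp add: exp_minus)
  then show thesis by (rule that)
qed

section \<open>Square integrability on the cylinder and growth along its ends\<close>

text \<open>Characters have modulus 1, so c is at most the integral of |g|. Integrating 2c|g| \<le>
  c^2 + |g|^2 over an interval of length 1 then replaces the Cauchy-Schwarz inequality.\<close>

lemma integral_norm_square_ge_fourier_coeff:
  assumes "continuous_on {0..1} g" "0 \<le> c" "c \<le> norm (fourier_coeff g n)"
  shows "c\<^sup>2 \<le> integral {0..1} (\<lambda>x. (norm (g x))\<^sup>2)"
proof -
  note int = integrable_continuous_interval continuous_intros assms(1)
  have "2 * c * norm (fourier_coeff g n) \<le> 2 * c * integral {0..1} (\<lambda>x. norm (g x))"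
    unfolding fourier_coeff_def using assms(2)
    by (intro mult_left_mono integral_norm_bound_integral) (auto intro!: int simp: norm_mult)
  also have "\<dots> = integral {0..1} (\<lambda>x. 2 * c * norm (g x))" by simp
  also have "\<dots> \<le> integral {0..1} (\<lambda>x. c\<^sup>2 + (norm (g x))\<^sup>2)"
  proof (rule integral_le)
    show "2 * c * norm (g x) \<le> c\<^sup>2 + (norm (g x))\<^sup>2" for x
      using sum_squares_bound[of c "norm (g x)"] by simp
  qed (auto intro!: int)
  also have "\<dots> = c\<^sup>2 + integral {0..1} (\<lambda>x. (norm (g x))\<^sup>2)"
    by (subst integral_add) (auto intro!: int)
  finally show ?thesis
    using mult_left_mono[OF assms(3), of "2 * c"] assms(2) by (simp add: power2_eq_square)
qed

text \<open>Fubini in the angular variable. Continuity makes every inner Lebesgue integral a gauge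
  integral, so the identity \<open>*\<close> holds for all r and not only almost everywhere.\<close>

lemma square_integrable_fibre_energy:
  assumes "square_integrable u" "continuous_on UNIV u"
  shows "integrable lborel (\<lambda>r. integral {0..1} (\<lambda>\<theta>. (norm (u (r, \<theta>)))\<^sup>2))"
proof -
  have *: "(LINT \<theta>|lborel. indicator (UNIV \<times> {0..<1}) (r, \<theta>) *\<^sub>R (norm (u (r, \<theta>)))\<^sup>2)
      = integral {0..1} (\<lambda>\<theta>. (norm (u (r, \<theta>)))\<^sup>2)" for r
  proof -
    have c: "continuous_on {0..1} (\<lambda>\<theta>. (norm (u (r, \<theta>)))\<^sup>2)"
      by (intro continuous_intros continuous_on_slice assms)
    have "set_integrable lborel {0..<1} (\<lambda>\<theta>. (norm (u (r, \<theta>)))\<^sup>2)"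
      using borel_integrable_atLeastAtMost'[OF c] by (rule set_integrable_subset) auto
    from set_borel_integral_eq_integral(2)[OF this]
    have "(LINT \<theta>:{0..<1}|lborel. (norm (u (r, \<theta>)))\<^sup>2) = integral {0..<1} (\<lambda>\<theta>. (norm (u (r, \<theta>)))\<^sup>2)" .
    \<comment> \<open>Closing the half-open fundamental domain adds only the null set {1}.\<close>
    also have "\<dots> = integral {0..1} (\<lambda>\<theta>. (norm (u (r, \<theta>)))\<^sup>2)"
      by (rule integral_spike_set) (auto intro: negligible_subset[of "{1}"])
    finally show ?thesis by (simp add: set_lebesgue_integral_def indicator_times)
  qed
  have "integrable (lborel \<Otimes>\<^sub>M lborel) (\<lambda>p. indicator (UNIV \<times> {0..<1}) p *\<^sub>R (norm (u p))\<^sup>2)"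
    using assms(1) by (simp add: square_integrable_def set_integrable_def lborel_prod)
  from lborel_pair.integrable_fst'[OF this] show ?thesis unfolding * .
qed

lemma emeasure_half_lines:
  "emeasure lborel {R :: real..} = \<infinity>" "emeasure lborel {..R :: real} = \<infinity>"
proof -
  have *: "emeasure lborel S = \<infinity>"
    if S: "S \<in> sets lborel" "\<And>n :: nat. \<exists>a :: real. {a..a + n} \<subseteq> S" for S
  proof (rule ccontr)
    assume "emeasure lborel S \<noteq> \<infinity>"
    then obtain n :: nat where n: "emeasure lborel S < of_nat n"
      using ennreal_Ex_less_of_nat[of "emeasure lborel S"] by (auto simp: less_top)
    obtain a :: real where "{a..a + real n} \<subseteq> S" using S(2)[of n] by blast
    from emeasure_mono[OF this S(1)] n show False
      by (simp add: ennreal_of_nat_eq_real_of_nat)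
  qed
  have "{R..R + n} \<subseteq> {R..}" "{R - n..R - n + n} \<subseteq> {..R}" for n :: nat by auto
  then show "emeasure lborel {R..} = \<infinity>" "emeasure lborel {..R} = \<infinity>"
    using *[of "{R..}"] *[of "{..R}"] by (simp_all only: sets_lborel atLeast_borel atMost_borel) blast+
qed

text \<open>No exponential growth is required. If H does not drop below H(R) on one half-line, the
  coefficient has modulus at least |c| exp(H R) there, which bounds an integrable energy from below
  on a set of infinite measure. So c = 0, and the coefficient vanishes for every r.\<close>

lemma fourier_coeff_eq_0_of_ode:
  assumes u: "smooth_section u" "square_integrable u"
    and ode: "\<And>r. ((\<lambda>r. fourier_coeff (\<lambda>\<theta>. u (r, \<theta>)) n) has_vector_derivative
           of_real (h r) * fourier_coeff (\<lambda>\<theta>. u (r, \<theta>)) n) (at r)"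
    and h: "continuous_on UNIV h" "(\<forall>r\<ge>R. h r \<ge> 0) \<or> (\<forall>r\<le>R. h r \<le> 0)"
  shows "fourier_coeff (\<lambda>\<theta>. u (r, \<theta>)) n = 0"
proof -
  obtain H where H: "\<And>r. (H has_real_derivative h r) (at r)"
    using primitive_exists[OF h(1)] by blast
  obtain c where c: "\<And>r. fourier_coeff (\<lambda>\<theta>. u (r, \<theta>)) n = c * of_real (exp (H r))"
    using linear_ode_solution[of "\<lambda>r. fourier_coeff (\<lambda>\<theta>. u (r, \<theta>)) n" h H, OF ode H] by blast
  obtain S where S: "S \<in> sets lborel" "emeasure lborel S = \<infinity>" "\<And>r. r \<in> S \<Longrightarrow> H R \<le> H r"
  proof (cases "\<forall>r\<ge>R. h r \<ge> 0")
    case True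
    have "H R \<le> H r" if "R \<le> r" for r
      using True H by (intro DERIV_nonneg_imp_nondecreasing[OF that]) blast
    then show ?thesis by (intro that[of "{R..}"]) (auto simp: emeasure_half_lines)
  next
    case False
    then have "\<forall>r\<le>R. h r \<le> 0" using h(2) by blast
    then have "H R \<le> H r" if "r \<le> R" for r
      using H by (intro DERIV_nonpos_imp_nonincreasing[OF that]) blast
    then show ?thesis by (intro that[of "{..R}"]) (auto simp: emeasure_half_lines)
  qed
  define b where "b = norm c * exp (H R)"
  let ?E = "\<lambda>r. integral {0..1} (\<lambda>\<theta>. (norm (u (r, \<theta>)))\<^sup>2)"
  have cont: "continuous_on UNIV u" by (rule smooth_section_continuous[OF u(1)])
  have E: "b\<^sup>2 \<le> ?E r" if "r \<in> S" for r
    by (rule integral_norm_square_ge_fourier_coeff[where n = n])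
       (auto simp: c b_def norm_mult S(3)[OF that] intro!: continuous_on_slice cont mult_left_mono)
  have "b = 0"
  proof (rule ccontr)
    assume "b \<noteq> 0"
    \<comment> \<open>The energy divided by b^2 dominates the indicator of S, which would make the
      measure of S finite.\<close>
    have "integrable lborel (indicator S :: real \<Rightarrow> real)"
    proof (rule Bochner_Integration.integrable_bound)
      show "integrable lborel (\<lambda>r. ?E r / b\<^sup>2)"
        by (intro integrable_divide square_integrable_fibre_energy u cont)
      show "AE r in lborel. norm (indicator S r :: real) \<le> norm (?E r / b\<^sup>2)"
        using E \<open>b \<noteq> 0\<close>
        by (intro AE_I2) (auto simp: indicator_def field_simps intro: order_trans[OF _ abs_ge_self])
    qed (use S in auto)
    then show False using S by (simp add: integrable_indicator_iff)
  qed
  then show ?thesis by (simp add: b_def c)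
qed

text \<open>The slope conditions make B(r) + |r| nonincreasing outwards beyond R, so its maximum
  over [-R, R] bounds it everywhere and exp(B) is dominated by a multiple of exp(-|r|).\<close>

lemma integrable_exp_of_linear_decay:
  fixes B :: "real \<Rightarrow> real"
  assumes B: "\<And>r. (B has_real_derivative h r) (at r)"
    and right: "\<And>r. r \<ge> R \<Longrightarrow> h r \<le> - 1" and left: "\<And>r. r \<le> - R \<Longrightarrow> h r \<ge> 1"
    and R: "R \<ge> 0"
  shows "integrable lborel (\<lambda>r. exp (B r))"
proof -
  have cB: "continuous_on S B" for S
    by (rule DERIV_continuous_on[OF has_field_derivative_at_within[OF B]])
  have "\<exists>x\<in>{-R..R}. \<forall>r\<in>{-R..R}. B r + \<bar>r\<bar> \<le> B x + \<bar>x\<bar>"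
    using R by (intro continuous_attains_sup continuous_intros cB) auto
  then obtain K where K: "\<And>r. r \<in> {-R..R} \<Longrightarrow> B r + \<bar>r\<bar> \<le> K" by blast
  have bound: "B r \<le> K - \<bar>r\<bar>" for r
  proof -
    consider "r \<in> {-R..R}" | "r \<ge> R" | "r \<le> - R" by fastforce
    then show ?thesis
    proof cases
      case 2
      have "\<exists>y. ((\<lambda>r. B r + r) has_real_derivative y) (at x) \<and> y \<le> 0" if "R \<le> x" for x
        using right[OF that] by (intro exI[of _ "h x + 1"]) (auto intro!: derivative_eq_intros B)
      then have "B r + r \<le> B R + R"
        by (intro DERIV_nonpos_imp_nonincreasing[OF 2]) blast
      then show ?thesis using K[of R] R 2 by simp
    next
      case 3
      have "\<exists>y. ((\<lambda>r. B r - r) has_real_derivative y) (at x) \<and> y \<ge> 0" if "x \<le> - R" for x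
        using left[OF that] by (intro exI[of _ "h x - 1"]) (auto intro!: derivative_eq_intros B)
      then have "B r - r \<le> B (- R) - (- R)"
        by (intro DERIV_nonneg_imp_nondecreasing[OF 3]) blast
      then show ?thesis using K[of "- R"] R 3 by simp
    qed (use K[of r] in simp)
  qed
  \<comment> \<open>One half of exp(-|r|). Adding its reflection counts the point 0 twice, so the
    sum dominates exp(-|r|) without being equal to it. The reflection is later written as the affine
    map \<open>0 + - 1 * r\<close>, the form in which integrability is transported.\<close>
  define G :: "real \<Rightarrow> real" where "G r = indicator {0..} r * exp (- r)" for r
  have G: "integrable lborel G"
    using nonnegative_absolutely_integrable_1[OF integrable_on_exp_minus_to_infinity[of 1 0]]
    unfolding G_def by (simp add: set_integrable_def integrable_completion)
  have "integrable lborel (\<lambda>r. exp K * (G r + G (0 + - 1 * r)))"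
    by (intro integrable_mult_right Bochner_Integration.integrable_add G lborel_integrable_real_affine) simp
  then show ?thesis
  proof (rule Bochner_Integration.integrable_bound)
    show "(\<lambda>r. exp (B r)) \<in> borel_measurable lborel"
      by (auto intro!: borel_measurable_continuous_onI continuous_intros cB)
    have "exp (B r) \<le> exp K * (G r + G (- r))" for r
    proof -
      have "exp (B r) \<le> exp K * exp (- \<bar>r\<bar>)"
        using bound[of r] by (simp flip: exp_add)
      also have "\<dots> \<le> exp K * (G r + G (- r))"
        by (intro mult_left_mono) (auto simp: G_def indicator_def)
      finally show ?thesis .
    qed
    then show "AE r in lborel. norm (exp (B r)) \<le> norm (exp K * (G r + G (0 + - 1 * r)))"
      by (intro AE_I2) (auto intro: order_trans[OF _ abs_ge_self])
  qed
qed

text \<open>Characters have modulus 1, so the squared norm is a function of r alone, and on the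
  product it is multiplied only by the indicator of the unit interval.\<close>

lemma square_integrable_fourier_section:
  assumes "integrable lborel (\<lambda>r. (a r)\<^sup>2)" "continuous_on UNIV a"
  shows "square_integrable (fourier_section a n)"
proof -
  have norm: "(norm (fourier_section a n p))\<^sup>2 = (a (fst p))\<^sup>2" for p
    using norm_fourier_char[of n "snd p"]
    by (simp add: fourier_section_def fourier_char_def split_beta norm_mult)
  have [measurable]: "a \<in> borel_measurable borel"
    using assms(2) by (rule borel_measurable_continuous_onI)
  have "integrable (lborel \<Otimes>\<^sub>M lborel) (\<lambda>p. (a (fst p))\<^sup>2 * indicator {0..<1::real} (snd p))"
    by (rule lborel_pair.Fubini_integrable) (use assms in \<open>auto simp: abs_mult\<close>)
  then show ?thesis
    unfolding square_integrable_def set_integrable_def norm lborel_prod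
    by (rule back_subst[of "integrable lborel"]) (auto simp: fun_eq_iff indicator_def)
qed

section \<open>Weights\<close>

lemma fourier_section_eq: "fourier_section a n p = of_real (a (fst p)) * fourier_char n (snd p)"
  by (simp add: fourier_section_def fourier_char_def split_beta)

lemma rotate_fourier_section:
  "rotate_section \<alpha> (fourier_section a n) = cscale (fourier_char n \<alpha>) (fourier_section a n)"
  by (auto simp: rotate_section_def cscale_def fun_eq_iff fourier_section_eq fourier_char_add)

lemma fourier_char_eq_imp_eq:
  assumes "\<And>\<alpha>. fourier_char n \<alpha> = fourier_char k \<alpha>"
  shows "n = k"
proof (rule ccontr)
  assume "n \<noteq> k"
  define d where "d = real_of_int (n - k)"
  have "d \<noteq> 0" using \<open>n \<noteq> k\<close> by (simp add: d_def)
  have "fourier_char (n - k) \<alpha> = 1" for \<alpha>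
    using fourier_char_mult[of n \<alpha> "- k"] fourier_char_mult[of k \<alpha> "- k"] assms[of \<alpha>] by simp
  \<comment> \<open>At this angle the character of index n - k equals cis(pi) = -1.\<close>
  from this[of "1 / (2 * d)"] have "cis (2 * pi * d * (1 / (2 * d))) = 1"
    by (simp only: fourier_char_cis d_def)
  also have "2 * pi * d * (1 / (2 * d)) = pi"
    using \<open>d \<noteq> 0\<close> by simp
  finally show False by simp
qed

lemma weight_space_eq:
  "weight_space V n = {u \<in> V. \<forall>\<alpha>. rotate_section \<alpha> u = cscale (fourier_char n \<alpha>) u}"
  by (simp only: weight_space_def fourier_char_def)

lemma rotate_section_zero: "rotate_section \<alpha> 0 = 0"
  by (simp add: rotate_section_def fun_eq_iff)

text \<open>The whole line rotates by the character n. A nonzero element that also had weight k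
  would force the characters k and n to agree at every angle.\<close>

lemma weight_space_span_fourier_section:
  assumes "fourier_section a n \<noteq> 0"
  shows "weight_space (sect_space.span {fourier_section a n}) k
    = (if k = n then sect_space.span {fourier_section a n} else {0})"
proof -
  let ?F = "fourier_section a n"
  have rot: "rotate_section \<alpha> (cscale c ?F) = cscale (fourier_char n \<alpha>) (cscale c ?F)" for c \<alpha>
    using rotate_fourier_section[of \<alpha> a n]
    by (auto simp: rotate_section_def cscale_def fun_eq_iff)
  have zero: "cscale c ?F = 0"
    if "k \<noteq> n" "\<And>\<alpha>. rotate_section \<alpha> (cscale c ?F) = cscale (fourier_char k \<alpha>) (cscale c ?F)" for c
  proof (rule ccontr)
    assume nz: "cscale c ?F \<noteq> 0"
    have "fourier_char k \<alpha> = fourier_char n \<alpha>" for \<alpha>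
      using that(2)[of \<alpha>] nz unfolding rot sect_space.scale_cancel_right by metis
    then have "k = n" by (rule fourier_char_eq_imp_eq)
    with that(1) show False by simp
  qed
  show ?thesis
  proof (cases "k = n")
    case True
    then show ?thesis
      unfolding weight_space_eq sect_space.span_singleton using rot by auto
  next
    case False
    have "u = 0" if u: "u \<in> weight_space (sect_space.span {?F}) k" for u
    proof -
      obtain c where "u = cscale c ?F"
        using u unfolding weight_space_eq sect_space.span_singleton by blast
      with u zero[OF False, of c] show ?thesis unfolding weight_space_eq by blast
    qed
    moreover have "0 \<in> weight_space (sect_space.span {?F}) k"
      by (simp add: weight_space_eq sect_space.span_zero rotate_section_zero)
    ultimately show ?thesis using False by auto
  qed
qed

lemma rep_class_span_fourier_section:
  assumes "fourier_section a n \<noteq> 0"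
  shows "rep_class (sect_space.span {fourier_section a n}) = C_weight n"
proof -
  have "sect_space.dim (sect_space.span {fourier_section a n}) = 1"
    using assms by (simp add: sect_space.dim_span sect_space.dim_eq_card_independent
        sect_space.independent_insert sect_space.dependent_single)
  moreover have "sect_space.dim {0} = 0"
    using sect_space.dim_span_eq_card_independent[OF sect_space.independent_empty]
    by (simp only: sect_space.span_empty card.empty)
  \<comment> \<open>The multiplicity function is brought into the form in which
    \<open>single\<close> is itself an \<open>Abs_poly_mapping\<close>, so both sides apply it to
    the same function.\<close>
  ultimately have "(\<lambda>k. int (sect_space.dim (weight_space (sect_space.span {fourier_section a n}) k)))
      = (\<lambda>k. 1 when n = k)"
    unfolding weight_space_span_fourier_section[OF assms] by (auto simp: when_def)
  then show ?thesis
    by (simp add: rep_class_def C_weight_def Poly_Mapping.single.abs_eq)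
qed

lemma rep_class_zero: "rep_class {0} = 0"
proof -
  have w: "weight_space {0} n = {0}" for n
    unfolding weight_space_eq by (auto simp: rotate_section_zero)
  have d: "sect_space.dim {0} = 0"
    using sect_space.dim_span_eq_card_independent[OF sect_space.independent_empty]
    by (simp only: sect_space.span_empty card.empty)
  show ?thesis
    unfolding rep_class_def w d zero_poly_mapping_def by (simp only: of_nat_0)
qed

section \<open>The kernels\<close>

lemma Ck_const: "Ck k (\<lambda>_. c)"
  by (induction k arbitrary: c) simp_all

lemma smooth_affine:
  fixes h :: "real \<Rightarrow> real"
  assumes "smooth h"
  shows "smooth (\<lambda>r. a * (b - h r))"
proof -
  have "Ck k (\<lambda>r. a * b + (- a) * h r)" for k
    using assms by (intro Ck_add Ck_mult Ck_const) (simp add: smooth_def)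
  then show ?thesis by (simp add: smooth_def algebra_simps)
qed

lemma has_derivative_cscale:
  assumes "smooth_section u"
  shows "(cscale c u has_derivative (\<lambda>v. c * frechet_derivative u (at p) v)) (at p)"
  unfolding cscale_def
  by (intro has_derivative_mult_right smooth_section_has_derivative assms)

lemma partial_cscale:
  assumes "smooth_section u"
  shows "partial_r (cscale c u) p = c * partial_r u p"
    and "partial_theta (cscale c u) p = c * partial_theta u p"
  by (simp_all only: partial_r_def partial_theta_def
      frechet_derivative_at[OF has_derivative_cscale[OF assms], symmetric])

lemma smooth_section_cscale:
  assumes "smooth_section u"
  shows "smooth_section (cscale c u)"
proof -
  have "Ck k (cscale c u)" for k
    unfolding cscale_def
    using assms by (intro Ck_mult Ck_const) (simp only: smooth_section_def smooth_def)
  moreover have "cscale c u (r, \<theta> + 1) = cscale c u (r, \<theta>)" for r \<theta>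
    using assms by (simp add: cscale_def smooth_section_def)
  ultimately show ?thesis unfolding smooth_section_def smooth_def by blast
qed

lemma square_integrable_cscale:
  assumes "square_integrable u"
  shows "square_integrable (cscale c u)"
  using set_integrable_mult_right[OF assms[unfolded square_integrable_def], of "(norm c)\<^sup>2"]
  by (simp add: square_integrable_def cscale_def norm_mult power_mult_distrib)

text \<open>With s = 0 the \<open>\<epsilon>1\<close> term disappears, and \<open>f r powr 0\<close>
  is 1 because f is positive (\<open>0 powr 0\<close> would be 0). Solving for the radial derivative
  gives the form of \<open>fourier_coeff_ode\<close> with \<kappa> = 1 + t.\<close>

lemma D_plus_eq_0_iff:
  assumes "\<And>r. f r > 0"
  shows "D_plus \<rho> f 0 t \<epsilon>1 0 u = 0 \<longleftrightarrow> (\<forall>p. partial_r u p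
    = - \<i> * of_real (1 + t) * (partial_theta u p - 2 * of_real pi * \<i> * of_real (\<rho> (fst p)) * u p))"
proof -
  have f: "f r \<noteq> 0" for r using assms[of r] by simp
  have eq_iff: "c * x - \<i> * y = 0 \<longleftrightarrow> y = - \<i> * c * x" for c x y :: complex
    using i_squared by algebra
  have "D_plus \<rho> f 0 t \<epsilon>1 0 u p = 0 \<longleftrightarrow> partial_r u p
    = - \<i> * of_real (1 + t) * (partial_theta u p - 2 * of_real pi * \<i> * of_real (\<rho> (fst p)) * u p)" for p
    using eq_iff[of "1 + of_real t" _ "partial_r u p"] by (simp add: D_plus_eq f)
  then show ?thesis by (simp only: fun_eq_iff zero_fun_def)
qed

lemma D_minus_eq_0_iff:
  assumes "\<And>r. f r > 0"
  shows "D_minus \<rho> f 0 t \<epsilon>1 0 u = 0 \<longleftrightarrow> (\<forall>p. partial_r u p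
    = - \<i> * of_real (- (1 + t)) * (partial_theta u p - 2 * of_real pi * \<i> * of_real (\<rho> (fst p)) * u p))"
proof -
  have f: "f r \<noteq> 0" for r using assms[of r] by simp
  have eq_iff: "c * x - \<i> * y = 0 \<longleftrightarrow> y = - \<i> * c * x" for c x y :: complex
    using i_squared by algebra
  have "D_minus \<rho> f 0 t \<epsilon>1 0 u p = 0 \<longleftrightarrow> partial_r u p
    = - \<i> * of_real (- (1 + t)) * (partial_theta u p - 2 * of_real pi * \<i> * of_real (\<rho> (fst p)) * u p)" for p
    using eq_iff[of "- (1 + of_real t)" _ "partial_r u p"] by (simp add: D_minus_eq f)
  then show ?thesis by (simp only: fun_eq_iff zero_fun_def)
qed

lemma eq_of_fourier_coeff_eq:
  assumes u: "continuous_on UNIV u" "\<And>r \<theta>. u (r, \<theta> + 1) = u (r, \<theta>)"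
    and v: "continuous_on UNIV v" "\<And>r \<theta>. v (r, \<theta> + 1) = v (r, \<theta>)"
    and coeff: "\<And>r n. fourier_coeff (\<lambda>\<theta>. u (r, \<theta>)) n = fourier_coeff (\<lambda>\<theta>. v (r, \<theta>)) n"
  shows "u = v"
proof -
  have "u (r, \<theta>) = v (r, \<theta>)" for r \<theta>
  proof -
    note cu = continuous_on_slice[OF u(1), of "{0..1}" r] and cv = continuous_on_slice[OF v(1), of "{0..1}" r]
    define g where "g = (\<lambda>\<theta>. u (r, \<theta>) - v (r, \<theta>))"
    have "fourier_coeff g n = 0" for n
    proof -
      have "fourier_coeff g n = integral {0..1} (\<lambda>x. fourier_char (- n) x * u (r, x) - fourier_char (- n) x * v (r, x))"
        by (simp only: fourier_coeff_def g_def right_diff_distrib)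
      also have "\<dots> = fourier_coeff (\<lambda>\<theta>. u (r, \<theta>)) n - fourier_coeff (\<lambda>\<theta>. v (r, \<theta>)) n"
        unfolding fourier_coeff_def
        by (intro integral_diff integrable_continuous_interval continuous_intros cu cv)
      finally show ?thesis by (simp add: coeff)
    qed
    moreover have "continuous_on {0..1} g"
      unfolding g_def by (intro continuous_on_diff cu cv)
    moreover have "g 0 = g 1"
      using u(2)[of r 0] v(2)[of r 0] by (simp add: g_def)
    \<comment> \<open>Uniqueness speaks only about [0,1]; periodicity carries the value at the
      fractional part to an arbitrary angle.\<close>
    moreover have "frac \<theta> \<in> {0..1}"
      using frac_ge_0[of \<theta>] frac_lt_1[of \<theta>] by simp
    ultimately have "g (frac \<theta>) = 0" by (intro fourier_unique[where g = g and x = "frac \<theta>"])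
    moreover interpret U: periodic_fun_simple' "\<lambda>\<theta>. u (r, \<theta>)" by unfold_locales (rule u)
    interpret V: periodic_fun_simple' "\<lambda>\<theta>. v (r, \<theta>)" by unfold_locales (rule v)
    have "u (r, frac \<theta>) = u (r, \<theta>)" "v (r, frac \<theta>) = v (r, \<theta>)"
      unfolding frac_def by (rule U.minus_of_int, rule V.minus_of_int)
    ultimately show ?thesis by (simp add: g_def)
  qed
  then show ?thesis by auto
qed

lemma fourier_coeff_kernel_eq_0:
  fixes m n :: int
  assumes rho: "continuous_on UNIV \<rho>"
      "\<And>r. r < of_int m - 1/2 \<Longrightarrow> \<rho> r = of_int m - 1/2"
      "\<And>r. r > of_int m + 1/2 \<Longrightarrow> \<rho> r = of_int m + 1/2"
    and u: "smooth_section u" "square_integrable u"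
    and pde: "\<And>p. partial_r u p
      = - \<i> * of_real \<kappa> * (partial_theta u p - 2 * of_real pi * \<i> * of_real (\<rho> (fst p)) * u p)"
    and sign: "\<kappa> < 0 \<or> n \<noteq> m"
  shows "fourier_coeff (\<lambda>\<theta>. u (r, \<theta>)) n = 0"
proof -
  let ?h = "\<lambda>r. 2 * pi * \<kappa> * (n - \<rho> r)"
  \<comment> \<open>The end values of \<rho> are prescribed strictly beyond m + 1/2 and m - 1/2; the
    thresholds m + 1 and m - 1 lie inside these ranges.\<close>
  have right: "\<rho> r = m + 1/2" if "r \<ge> m + 1" for r :: real using rho(3)[of r] that by simp
  have left: "\<rho> r = m - 1/2" if "r \<le> m - 1" for r :: real using rho(2)[of r] that by simp
  \<comment> \<open>Each case names an end where the coefficient cannot decay outwards: the right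
    one in the first and last cases, the left one in the other two. The weight n = m occurs only
    with \<kappa> \<le> 0; for \<kappa> > 0 it would decay at both ends.\<close>
  consider "\<kappa> \<le> 0" "n \<le> m" | "\<kappa> \<le> 0" "n \<ge> m + 1" | "\<kappa> \<ge> 0" "n \<le> m - 1" | "\<kappa> \<ge> 0" "n \<ge> m + 1"
    using sign by (cases "\<kappa> < 0"; cases "n \<le> m") auto
  then obtain R where R: "(\<forall>r\<ge>R. ?h r \<ge> 0) \<or> (\<forall>r\<le>R. ?h r \<le> 0)"
  proof cases
    case 1
    have "?h r \<ge> 0" if "r \<ge> m + 1" for r :: real
      using 1 right[OF that] by (intro mult_nonpos_nonpos[OF mult_nonneg_nonpos]) auto
    then show thesis by (intro that) blast
  next
    case 2
    have "?h r \<le> 0" if "r \<le> m - 1" for r :: real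
      using 2 left[OF that] by (intro mult_nonpos_nonneg[OF mult_nonneg_nonpos]) auto
    then show thesis by (intro that) blast
  next
    case 3
    have "?h r \<le> 0" if "r \<le> m - 1" for r :: real
      using 3 left[OF that] by (intro mult_nonneg_nonpos[OF mult_nonneg_nonneg]) auto
    then show thesis by (intro that) blast
  next
    case 4
    have "?h r \<ge> 0" if "r \<ge> m + 1" for r :: real
      using 4 right[OF that] by (intro mult_nonneg_nonneg[OF mult_nonneg_nonneg]) auto
    then show thesis by (intro that) blast
  qed
  have "continuous_on UNIV ?h"
    by (intro continuous_intros rho)
  from fourier_coeff_eq_0_of_ode[OF u fourier_coeff_ode[OF u(1) pde] this R] show ?thesis .
qed

text \<open>Here \<kappa> = -(1 + t) is negative, so every weight is excluded, m included.\<close>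

lemma ker_L2_D_minus:
  fixes m :: int
  assumes rho: "continuous_on UNIV \<rho>"
      "\<And>r. r < of_int m - 1/2 \<Longrightarrow> \<rho> r = of_int m - 1/2"
      "\<And>r. r > of_int m + 1/2 \<Longrightarrow> \<rho> r = of_int m + 1/2"
    and f: "\<And>r. f r > 0" and t: "t \<ge> 0"
  shows "ker_L2 (D_minus \<rho> f 0 t \<epsilon>1 0) = {0}"
proof (intro equalityI subsetI)
  fix u assume "u \<in> ker_L2 (D_minus \<rho> f 0 t \<epsilon>1 0)"
  then have u: "smooth_section u" "square_integrable u" and "D_minus \<rho> f 0 t \<epsilon>1 0 u = 0"
    by (simp_all add: ker_L2_def)
  from this(3) have pde: "partial_r u p = - \<i> * of_real (- (1 + t))
      * (partial_theta u p - 2 * of_real pi * \<i> * of_real (\<rho> (fst p)) * u p)" for p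
    unfolding D_minus_eq_0_iff[OF f] by blast
  have "fourier_coeff (\<lambda>\<theta>. u (r, \<theta>)) n = 0" for r n
    by (rule fourier_coeff_kernel_eq_0[OF rho u pde]) (use t in auto)
  then have "u = (\<lambda>_. 0)"
    using u(1) smooth_section_continuous[OF u(1)]
    by (intro eq_of_fourier_coeff_eq) (auto simp: smooth_section_def fourier_coeff_def)
  then show "u \<in> {0}" by (simp add: zero_fun_def)
next
  fix u :: sect assume "u \<in> {0}"
  then have u: "u = (\<lambda>_. 0)" by (simp add: zero_fun_def)
  have "smooth_section u" unfolding u smooth_section_def smooth_def by (simp add: Ck_const)
  moreover have "square_integrable u" unfolding u square_integrable_def by (simp add: set_integrable_def)
  moreover have "D_minus \<rho> f 0 t \<epsilon>1 0 u = 0"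
    unfolding D_minus_eq_0_iff[OF f] u by (simp add: partial_r_def partial_theta_def)
  ultimately show "u \<in> ker_L2 (D_minus \<rho> f 0 t \<epsilon>1 0)" by (simp add: ker_L2_def)
qed

lemma ker_L2_D_plus:
  fixes m :: int
  assumes rho_smooth: "smooth \<rho>"
    and rho_left: "\<And>r. r < of_int m - 1/2 \<Longrightarrow> \<rho> r = of_int m - 1/2"
    and rho_right: "\<And>r. r > of_int m + 1/2 \<Longrightarrow> \<rho> r = of_int m + 1/2"
    and f: "\<And>r. f r > 0" and t: "t \<ge> 0"
    and A: "\<And>r. (A has_real_derivative (1 + t) * (of_int m - \<rho> r)) (at r)"
  shows "ker_L2 (D_plus \<rho> f 0 t \<epsilon>1 0) = sect_space.span {fourier_section (\<lambda>r. exp (2 * pi * A r)) m}"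
proof -
  have "Ck 0 \<rho>" using rho_smooth unfolding smooth_def by blast
  then have rho: "continuous_on UNIV \<rho>" by simp
  let ?F = "fourier_section (\<lambda>r. exp (2 * pi * A r)) m"
  let ?pde = "\<lambda>u p. partial_r u p
    = - \<i> * of_real (1 + t) * (partial_theta u p - 2 * of_real pi * \<i> * of_real (\<rho> (fst p)) * u p)"
  \<comment> \<open>Needed for two factors: 2 pi for the section itself and 4 pi for its squared
    modulus.\<close>
  have A': "((\<lambda>r. c * A r) has_real_derivative (c * (1 + t)) * (of_int m - \<rho> r)) (at r)" for c r
    using DERIV_cmult[OF A, of c r] by (simp only: mult.assoc)
  have F_smooth: "smooth_section ?F"
    by (intro smooth_section_fourier_section[OF A'] smooth_affine rho_smooth)
  have "integrable lborel (\<lambda>r. exp (4 * pi * A r))"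
  \<comment> \<open>The decay lemma uses a radius symmetric about 0, and |m| + 1 places both ends
    beyond the transition region around m. There m - \<rho> is -1/2 on the right and 1/2 on the
    left, so the slope has modulus 2 pi (1 + t) \<ge> 1.\<close>
  proof (rule integrable_exp_of_linear_decay[OF A', where R = "real_of_int \<bar>m\<bar> + 1"])
    have big: "1 \<le> 2 * pi * (1 + t)"
      using mult_mono[of 1 "2 * pi" 1 "1 + t"] pi_ge_two t by simp
    show "4 * pi * (1 + t) * (m - \<rho> r) \<le> - 1" if "r \<ge> real_of_int \<bar>m\<bar> + 1" for r
      using big rho_right[of r] that by simp
    show "4 * pi * (1 + t) * (m - \<rho> r) \<ge> 1" if "r \<le> - (real_of_int \<bar>m\<bar> + 1)" for r
      using big rho_left[of r] that by simp
  qed simp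
  moreover have "exp (4 * pi * A r) = (exp (2 * pi * A r))\<^sup>2" for r
  proof -
    have "4 * pi * A r = 2 * (2 * pi * A r)" by simp
    then show ?thesis by (simp only: exp_double)
  qed
  ultimately have "integrable lborel (\<lambda>r. (exp (2 * pi * A r))\<^sup>2)"
    by (simp only:)
  moreover have "continuous_on UNIV (\<lambda>r. exp (2 * pi * A r))"
    by (intro continuous_intros DERIV_continuous_on[OF has_field_derivative_at_within[OF A]])
  ultimately have F_L2: "square_integrable ?F"
    by (rule square_integrable_fourier_section)
  have F_pde: "?pde ?F p" for p
  proof -
    note D = frechet_derivative_at[OF has_derivative_fourier_section[OF A', of "2 * pi" m], symmetric]
    have "partial_r ?F p = ?F p * of_real (2 * pi * (1 + t) * (m - \<rho> (fst p)))"
      "partial_theta ?F p = ?F p * (2 * of_real pi * \<i> * of_int m)"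
      by (simp_all add: partial_r_def partial_theta_def D)
    then show ?thesis
      unfolding of_real_mult of_real_diff of_real_of_int_eq of_real_numeral of_real_add of_real_1
      using i_squared by algebra
  qed
  \<comment> \<open>Orthogonality to the other characters is not computed: the section is itself a
    square integrable solution, so the vanishing lemma applies to its coefficients with n \<noteq>
    m.\<close>
  have F_coeff: "fourier_coeff (\<lambda>\<theta>. ?F (r, \<theta>)) n = (if n = m then of_real (exp (2 * pi * A r)) else 0)" for r n
  proof (cases "n = m")
    case True
    have "fourier_char (- m) \<theta> * ?F (r, \<theta>) = of_real (exp (2 * pi * A r))" for \<theta>
      using fourier_char_mult[of "- m" \<theta> m] by (simp add: fourier_section_eq mult.left_commute)
    with True show ?thesis by (simp add: fourier_coeff_def)
  next
    case False
    then show ?thesis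
      using fourier_coeff_kernel_eq_0[OF rho rho_left rho_right F_smooth F_L2 F_pde, of n r] by simp
  qed
  show ?thesis
  proof (intro equalityI subsetI)
    fix u assume "u \<in> ker_L2 (D_plus \<rho> f 0 t \<epsilon>1 0)"
    then have u: "smooth_section u" "square_integrable u" and "D_plus \<rho> f 0 t \<epsilon>1 0 u = 0"
      by (simp_all add: ker_L2_def)
    from this(3) have pde: "?pde u p" for p
      unfolding D_plus_eq_0_iff[OF f] by blast
    \<comment> \<open>The weight-m coefficient solves a scalar first-order equation, which fixes it
      up to this constant. Hence c times the model section has the same coefficients as u.\<close>
    obtain c where c: "\<And>r. fourier_coeff (\<lambda>\<theta>. u (r, \<theta>)) m = c * of_real (exp (2 * pi * A r))"
      using linear_ode_solution[OF fourier_coeff_ode[OF u(1) pde, of m] A'] by blast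
    have cF: "smooth_section (cscale c ?F)" by (rule smooth_section_cscale[OF F_smooth])
    have "fourier_coeff (\<lambda>\<theta>. u (r, \<theta>)) n = fourier_coeff (\<lambda>\<theta>. cscale c ?F (r, \<theta>)) n" for r n
    proof -
      have "fourier_coeff (\<lambda>\<theta>. cscale c ?F (r, \<theta>)) n = c * fourier_coeff (\<lambda>\<theta>. ?F (r, \<theta>)) n"
        by (simp add: fourier_coeff_def cscale_def mult.left_commute[of _ c])
      moreover have "fourier_coeff (\<lambda>\<theta>. u (r, \<theta>)) n = 0" if "n \<noteq> m"
        using fourier_coeff_kernel_eq_0[OF rho rho_left rho_right u pde, of n r] that by simp
      ultimately show ?thesis by (cases "n = m") (simp_all add: F_coeff c)
    qed
    then have "u = cscale c ?F"
      using u(1) cF smooth_section_continuous[OF u(1)] smooth_section_continuous[OF cF]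
      by (intro eq_of_fourier_coeff_eq) (simp_all only: smooth_section_def)
    then show "u \<in> sect_space.span {?F}" unfolding sect_space.span_singleton by blast
  next
    fix u assume "u \<in> sect_space.span {?F}"
    then obtain c where u: "u = cscale c ?F" unfolding sect_space.span_singleton by blast
    have "?pde u p" for p
      unfolding u partial_cscale[OF F_smooth] F_pde[of p] by (simp add: cscale_def algebra_simps)
    then have "D_plus \<rho> f 0 t \<epsilon>1 0 u = 0"
      unfolding D_plus_eq_0_iff[OF f] by blast
    then show "u \<in> ker_L2 (D_plus \<rho> f 0 t \<epsilon>1 0)"
      unfolding ker_L2_def u
      using smooth_section_cscale[OF F_smooth] square_integrable_cscale[OF F_L2] by blast
  qed
qed

theorem propositionA3:
  fixes m :: int and \<rho> f A :: "real \<Rightarrow> real" and t \<epsilon>1 :: real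
  assumes rho_smooth: "smooth \<rho>"
    and rho_mono: "mono \<rho>"
    and rho_mid: "\<And>r. of_int m - 1/4 < r \<Longrightarrow> r < of_int m + 1/4 \<Longrightarrow> \<rho> r = r"
    and rho_left: "\<And>r. r < of_int m - 1/2 \<Longrightarrow> \<rho> r = of_int m - 1/2"
    and rho_right: "\<And>r. r > of_int m + 1/2 \<Longrightarrow> \<rho> r = of_int m + 1/2"
    and f_smooth: "smooth f"
    and f_pos: "\<And>r. f r > 0"
    and f_end: "\<exists>R. \<forall>r. \<bar>r\<bar> > R \<longrightarrow> f r = \<bar>r\<bar>"
    and t_nonneg: "t \<ge> 0"
    and eps1_nonneg: "\<epsilon>1 \<ge> 0"
    and A_primitive: "\<And>r. (A has_real_derivative (1 + t) * (of_int m - \<rho> r)) (at r)"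
  shows "ker_L2 (D_plus \<rho> f 0 t \<epsilon>1 0)
           = sect_space.span {fourier_section (\<lambda>r. exp (2 * pi * A r)) m}
       \<and> ker_L2 (D_minus \<rho> f 0 t \<epsilon>1 0) = {0}
       \<and> local_RR \<rho> f \<epsilon>1
           = rep_class (sect_space.span {fourier_section (\<lambda>r. exp (2 * pi * A r)) m})
       \<and> rep_class (sect_space.span {fourier_section (\<lambda>r. exp (2 * pi * A r)) m}) = C_weight m"

proof -
  \<comment> \<open>The primitive is a parameter because the index is evaluated at every t \<ge> 0,
    and each t has its own primitive; the given A belongs to the fixed t only.\<close>
  let ?F = "\<lambda>A. fourier_section (\<lambda>r. exp (2 * pi * A r)) m"
  have "Ck 0 \<rho>" using rho_smooth unfolding smooth_def by blast
  then have rho: "continuous_on UNIV \<rho>" by simp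
  have rep: "rep_class (sect_space.span {?F B}) = C_weight m" for B
  proof (rule rep_class_span_fourier_section)
    have "?F B (0, 0) \<noteq> 0" by (simp add: fourier_section_def)
    then show "?F B \<noteq> 0" by (metis zero_fun_apply)
  qed
  have index: "equivariant_L2_index (D_plus \<rho> f 0 t \<epsilon>1 0) (D_minus \<rho> f 0 t \<epsilon>1 0) = C_weight m"
    if "t \<ge> 0" for t
  proof -
    have "continuous_on UNIV (\<lambda>r. (1 + t) * (of_int m - \<rho> r))"
      by (intro continuous_intros rho)
    from primitive_exists[OF this]
    obtain B where B: "\<And>r. (B has_real_derivative (1 + t) * (of_int m - \<rho> r)) (at r)" by blast
    have "ker_L2 (D_plus \<rho> f 0 t \<epsilon>1 0) = sect_space.span {?F B}"
      by (rule ker_L2_D_plus[OF rho_smooth rho_left rho_right f_pos that B])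
    moreover have "ker_L2 (D_minus \<rho> f 0 t \<epsilon>1 0) = {0}"
      by (rule ker_L2_D_minus[OF rho rho_left rho_right f_pos that])
    ultimately show ?thesis
      by (simp only: equivariant_L2_index_def rep rep_class_zero diff_zero)
  qed
  have ev: "\<forall>\<^sub>F t in at_top. equivariant_L2_index (D_plus \<rho> f 0 t \<epsilon>1 0) (D_minus \<rho> f 0 t \<epsilon>1 0) = C_weight m"
    using eventually_ge_at_top[of 0] by (rule eventually_mono) (rule index)
  have "local_RR \<rho> f \<epsilon>1 = C_weight m"
    unfolding local_RR_def
  proof (rule the_equality, rule ev)
    fix R assume "\<forall>\<^sub>F t in at_top. equivariant_L2_index (D_plus \<rho> f 0 t \<epsilon>1 0) (D_minus \<rho> f 0 t \<epsilon>1 0) = R"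
    \<comment> \<open>Two eventual values agree at some common t because \<open>at_top\<close> is a
      proper filter; this is the uniqueness behind the definite description.\<close>
    with ev have "\<forall>\<^sub>F t in at_top :: real filter. R = C_weight m"
      by eventually_elim simp
    then show "R = C_weight m" by simp
  qed
  moreover have "ker_L2 (D_plus \<rho> f 0 t \<epsilon>1 0) = sect_space.span {?F A}"
    by (rule ker_L2_D_plus[OF rho_smooth rho_left rho_right f_pos t_nonneg A_primitive])
  moreover have "ker_L2 (D_minus \<rho> f 0 t \<epsilon>1 0) = {0}"
    by (rule ker_L2_D_minus[OF rho rho_left rho_right f_pos t_nonneg])
  ultimately show ?thesis using rep by (intro conjI) simp_all
qed

end
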